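(* Consider a graph problem on a fixed graph whose instances are given by edge weights $c\in\mathbb{R}^m$ drawn from an unknown distribution $\mathcal{D}$, and let $h^*(c)\in\mathcal{H}\subseteq\mathbb{R}^d$ denote an optimal hint for instance $c$. Define $\ell_\infty(h,c)=\|h^*(c)-h\|_\infty$. Assume (bounded range) there is $M$ such that for every $h\in\mathcal{H}$, $h_i\in[-M,M]$ for all $i$; and (efficient optimization) there is a polynomial-time algorithm that, given i.i.d. samples $c_1,\dots,c_s\sim\mathcal{D}$, finds $h\in\mathcal{H}$ minimizing $\sum_{i=1}^s\|h^*(c_i)-h\|_\infty$. Then there is a polynomial-time algorithm that, given $s=O\big((dM/\epsilon)^2(d+\log(1/\delta))\big)$ i.i.d. samples from $\mathcal{D}$, returns $h\in\mathcal{H}$ such that, with probability at least $1-\delta$, \[\mathbb{E}_{c\sim\mathcal{D}}\ell_\infty(h,c)\le \min_{h'\in\mathcal{H}}\mathbb{E}_{c\sim\mathcal{D}}\ell_\infty(h',c)+\epsilon.\]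
   Context: The map $c\mapsto h^*(c)$ is an arbitrary fixed problem-dependent function (e.g. an optimal LP dual solution); no assumption is made on $\mathcal{D}$. *)

theory Defs
  imports "HOL-Probability.Probability" "HOL-Computational_Algebra.Polynomial"
begin

text \<open>
  Vectors of dimension \<open>n\<close> are the functions of \<open>rvec n\<close>, i.e. the carrier of the product
  space \<open>\<Pi>\<^sub>M i\<in>{..<n}. borel\<close>.  The dimension is a term, not a type, because the constant
  hidden in the O-bound must not depend on it.
\<close>

abbreviation rvec :: "nat \<Rightarrow> (nat \<Rightarrow> real) set" where
  "rvec n \<equiv> {..<n} \<rightarrow>\<^sub>E UNIV"

text \<open>The inserted \<open>0\<close> only matters for \<open>n = 0\<close>.\<close>

definition linf_norm :: "nat \<Rightarrow> (nat \<Rightarrow> real) \<Rightarrow> real" where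
  "linf_norm n x = Max (insert 0 ((\<lambda>i. \<bar>x i\<bar>) ` {..<n}))"

definition linf_loss ::
  "nat \<Rightarrow> ((nat \<Rightarrow> real) \<Rightarrow> nat \<Rightarrow> real) \<Rightarrow> (nat \<Rightarrow> real) \<Rightarrow> (nat \<Rightarrow> real) \<Rightarrow> real" where
  "linf_loss d hstar h c = linf_norm d (\<lambda>i. hstar c i - h i)"

text \<open>
  Finite graphs.  The edges are listed, so that coordinate \<open>k\<close> of a weight vector is the weight
  of the \<open>k\<close>-th edge; for an undirected graph the order of the two end points carries no meaning.
\<close>

record graph =
  verts :: "nat set"
  edges :: "(nat \<times> nat) list"

definition finite_graph :: "graph \<Rightarrow> bool" where
  "finite_graph G \<longleftrightarrow> finite (verts G) \<and> set (edges G) \<subseteq> verts G \<times> verts G"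

abbreviation num_edges :: "graph \<Rightarrow> nat" where
  "num_edges G \<equiv> length (edges G)"

text \<open>
  Instances are real vectors, so algorithms are programs of the unit-cost real RAM (the
  Blum-Shub-Smale model with indirect addressing): exact field operations and comparisons on
  reals, additive arithmetic and comparisons on the natural numbers used as counters and addresses.
  There are no rounding operations, and no multiplication of addresses, since these would make
  the unit-cost measure unreasonable.
\<close>

datatype instr =
    RConst nat real
  | RAdd nat nat nat
  | RSub nat nat nat
  | RMul nat nat nat
  | RDiv nat nat nat
  | RLoad nat nat
  | RStore nat nat
  | NConst nat nat
  | NAdd nat nat nat
  | NSub nat nat nat
  | NLoad nat nat
  | NStore nat nat
  | RJumpLess nat nat nat
  | NJumpLess nat nat nat

type_synonym program = "instr list"

text \<open>Registers are addressed directly, memory cells through the contents of a register.\<close>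

record ram_state =
  pc :: nat
  rreg :: "nat \<Rightarrow> real"
  rmem :: "nat \<Rightarrow> real"
  nreg :: "nat \<Rightarrow> nat"
  nmem :: "nat \<Rightarrow> nat"

fun exec_instr :: "instr \<Rightarrow> ram_state \<Rightarrow> ram_state" where
  "exec_instr (RConst i a) \<sigma> = \<sigma>\<lparr>pc := pc \<sigma> + 1, rreg := (rreg \<sigma>)(i := a)\<rparr>"
| "exec_instr (RAdd i j k) \<sigma> = \<sigma>\<lparr>pc := pc \<sigma> + 1, rreg := (rreg \<sigma>)(i := rreg \<sigma> j + rreg \<sigma> k)\<rparr>"
| "exec_instr (RSub i j k) \<sigma> = \<sigma>\<lparr>pc := pc \<sigma> + 1, rreg := (rreg \<sigma>)(i := rreg \<sigma> j - rreg \<sigma> k)\<rparr>"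
| "exec_instr (RMul i j k) \<sigma> = \<sigma>\<lparr>pc := pc \<sigma> + 1, rreg := (rreg \<sigma>)(i := rreg \<sigma> j * rreg \<sigma> k)\<rparr>"
| "exec_instr (RDiv i j k) \<sigma> = \<sigma>\<lparr>pc := pc \<sigma> + 1, rreg := (rreg \<sigma>)(i := rreg \<sigma> j / rreg \<sigma> k)\<rparr>"
| "exec_instr (RLoad i x) \<sigma> = \<sigma>\<lparr>pc := pc \<sigma> + 1, rreg := (rreg \<sigma>)(i := rmem \<sigma> (nreg \<sigma> x))\<rparr>"
| "exec_instr (RStore x i) \<sigma> = \<sigma>\<lparr>pc := pc \<sigma> + 1, rmem := (rmem \<sigma>)(nreg \<sigma> x := rreg \<sigma> i)\<rparr>"
| "exec_instr (NConst i a) \<sigma> = \<sigma>\<lparr>pc := pc \<sigma> + 1, nreg := (nreg \<sigma>)(i := a)\<rparr>"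
| "exec_instr (NAdd i j k) \<sigma> = \<sigma>\<lparr>pc := pc \<sigma> + 1, nreg := (nreg \<sigma>)(i := nreg \<sigma> j + nreg \<sigma> k)\<rparr>"
| "exec_instr (NSub i j k) \<sigma> = \<sigma>\<lparr>pc := pc \<sigma> + 1, nreg := (nreg \<sigma>)(i := nreg \<sigma> j - nreg \<sigma> k)\<rparr>"
| "exec_instr (NLoad i x) \<sigma> = \<sigma>\<lparr>pc := pc \<sigma> + 1, nreg := (nreg \<sigma>)(i := nmem \<sigma> (nreg \<sigma> x))\<rparr>"
| "exec_instr (NStore x i) \<sigma> = \<sigma>\<lparr>pc := pc \<sigma> + 1, nmem := (nmem \<sigma>)(nreg \<sigma> x := nreg \<sigma> i)\<rparr>"
| "exec_instr (RJumpLess i j l) \<sigma> = \<sigma>\<lparr>pc := (if rreg \<sigma> i < rreg \<sigma> j then l else pc \<sigma> + 1)\<rparr>"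
| "exec_instr (NJumpLess i j l) \<sigma> = \<sigma>\<lparr>pc := (if nreg \<sigma> i < nreg \<sigma> j then l else pc \<sigma> + 1)\<rparr>"

definition halted :: "program \<Rightarrow> ram_state \<Rightarrow> bool" where
  "halted P \<sigma> \<longleftrightarrow> length P \<le> pc \<sigma>"

definition step :: "program \<Rightarrow> ram_state \<Rightarrow> ram_state" where
  "step P \<sigma> = (if halted P \<sigma> then \<sigma> else exec_instr (P ! pc \<sigma>) \<sigma>)"

text \<open>
  The input is \<open>s\<close> vectors of dimension \<open>m\<close>, written one after the other into the real memory;
  the number \<open>s\<close> is in register \<open>0\<close>.
\<close>

definition init_state :: "nat \<Rightarrow> nat \<Rightarrow> (nat \<Rightarrow> nat \<Rightarrow> real) \<Rightarrow> ram_state" where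
  "init_state m s c =
     \<lparr>pc = 0,
      rreg = (\<lambda>_. 0),
      rmem = (\<lambda>a. if a < s * m then c (a div m) (a mod m) else 0),
      nreg = (\<lambda>_. 0)(0 := s),
      nmem = (\<lambda>_. 0)\<rparr>"

text \<open>The output is read from the first \<open>d\<close> cells of the real memory.\<close>

definition returns_within ::
  "program \<Rightarrow> nat \<Rightarrow> nat \<Rightarrow> nat \<Rightarrow> nat \<Rightarrow> (nat \<Rightarrow> nat \<Rightarrow> real) \<Rightarrow> (nat \<Rightarrow> real) \<Rightarrow> bool" where
  "returns_within P T m d s c h \<longleftrightarrow>
     (\<exists>t\<le>T. let \<sigma> = (step P ^^ t) (init_state m s c)
            in halted P \<sigma> \<and> h = restrict (rmem \<sigma>) {..<d})"

text \<open>
  \<open>A s c\<close> is the output on the \<open>s\<close> samples \<open>c 0, \<dots>, c (s - 1)\<close>; one program handles all \<open>s\<close>.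
\<close>

definition computable_in_time ::
  "nat poly \<Rightarrow> nat \<Rightarrow> nat \<Rightarrow> (nat \<Rightarrow> (nat \<Rightarrow> nat \<Rightarrow> real) \<Rightarrow> nat \<Rightarrow> real) \<Rightarrow> bool" where
  "computable_in_time q m d A \<longleftrightarrow>
     (\<exists>P. \<forall>s. \<forall>c \<in> {..<s} \<rightarrow>\<^sub>E rvec m.
        returns_within P (poly q (s + m + d)) m d s c (A s c))"

text \<open>
  \<open>D\<close> is a probability distribution on the weight vectors for which the expected losses are
  meaningful: every Borel set is an event, and the losses (which are bounded) are random
  variables.  The \<sigma>-algebra may be larger than the Borel one, so that no regularity of \<open>hstar\<close>
  is imposed, e.g., when \<open>D\<close> is discrete.
\<close>

definition weight_distribution ::
  "nat \<Rightarrow> nat \<Rightarrow> (nat \<Rightarrow> real) set \<Rightarrow> ((nat \<Rightarrow> real) \<Rightarrow> nat \<Rightarrow> real) \<Rightarrow> (nat \<Rightarrow> real) measure \<Rightarrow> bool" where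
  "weight_distribution m d H hstar D \<longleftrightarrow>
     prob_space D \<and> space D = rvec m \<and> sets (\<Pi>\<^sub>M i\<in>{..<m}. borel) \<subseteq> sets D \<and>
     (\<forall>h\<in>H. linf_loss d hstar h \<in> borel_measurable D)"

text \<open>
  Inner probability: it agrees with \<open>p \<le> measure M {x \<in> space M. Q x}\<close> for measurable \<open>Q\<close>, and
  makes sense for an algorithm whose output does not depend measurably on the samples.
\<close>

definition with_prob_at_least :: "'a measure \<Rightarrow> real \<Rightarrow> ('a \<Rightarrow> bool) \<Rightarrow> bool" where
  "with_prob_at_least M p Q \<longleftrightarrow> (\<exists>E\<in>sets M. p \<le> measure M E \<and> (\<forall>x\<in>E. Q x))"

end

theory Submission
  imports Defs
begin

text \<open>
  The algorithm is empirical risk minimization itself.  A single net of \<open>H\<close> at scale \<open>\<epsilon>\<close>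
  with a union bound would cost a factor \<open>ln (M / \<epsilon>)\<close>, so the uniform deviation bound is obtained
  by chaining: \<open>h\<close> is reached from a nearly optimal \<open>h0\<close> through nets \<open>\<pi> k\<close> of scale \<open>2 M / 2 ^ k\<close> and
  size at most \<open>2 ^ ((k + 1) d)\<close>.  The loss is 1-Lipschitz in the sup norm, so the \<open>k\<close>-th increment is
  of order \<open>M / 2 ^ k\<close>; Hoeffding's inequality with deviation \<open>\<tau> (k + 1) / 2 ^ k\<close> beats the number of
  increments at every level, and these deviations sum to at most \<open>4 \<tau>\<close>.
\<close>

section \<open>Concentration of a single function over independent samples\<close>

text \<open>The coordinates of a product measure are independent copies of \<open>D\<close>, so
  Hoeffding's inequality applies to \<open>f (c i)\<close>. The lower tail is the harmful one:
  empirical minimization goes wrong when the sample makes a function look smaller than its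
  mean.\<close>

lemma prob_sum_PiM_le_Hoeffding:
  fixes f :: "'a \<Rightarrow> real"
  assumes D: "prob_space D" and f [measurable]: "f \<in> borel_measurable D"
    and B: "\<And>x. x \<in> space D \<Longrightarrow> \<bar>f x\<bar> \<le> B" "0 < B" and s: "0 < s" and t: "0 \<le> t"
  shows "measure (\<Pi>\<^sub>M i\<in>{..<s}. D)
           {c \<in> space (\<Pi>\<^sub>M i\<in>{..<s}. D). (\<Sum>i<s. f (c i)) \<le> real s * (LINT x|D. f x) - real s * t}
         \<le> exp (- (real s * t\<^sup>2 / (2 * B\<^sup>2)))"
proof -
  interpret D: prob_space D by fact
  interpret P: product_prob_space "\<lambda>_. D" "{..<s}" by unfold_locales
  let ?P = "\<Pi>\<^sub>M i\<in>{..<s}. D"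
  have comp: "distr ?P D (\<lambda>c. c i) = D" if "i < s" for i
    using that by (intro distr_PiM_component) (auto intro: D)
  \<comment> \<open>Independence means that the joint law is the product of the marginals. The joint
    map is the identity on extensional functions, so both sides are the product measure
    itself.\<close>
  have "P.indep_vars (\<lambda>_. D) (\<lambda>i c. c i) {..<s}"
  proof (subst P.indep_vars_iff_distr_eq_PiM')
    have "distr ?P ?P (\<lambda>c. \<lambda>i\<in>{..<s}. c i) = distr ?P ?P (\<lambda>c. c)"
      by (intro distr_cong) (auto simp: space_PiM PiE_def extensional_def fun_eq_iff)
    also have "\<dots> = ?P" by (rule distr_id)
    also have "\<dots> = (\<Pi>\<^sub>M i\<in>{..<s}. distr ?P D (\<lambda>c. c i))"
      by (intro PiM_cong) (auto simp: comp)
    finally show "distr ?P ?P (\<lambda>c. \<lambda>i\<in>{..<s}. c i) = (\<Pi>\<^sub>M i\<in>{..<s}. distr ?P D (\<lambda>c. c i))" .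
  qed (use s in auto)
  then have indep: "P.indep_vars (\<lambda>_. borel) (\<lambda>i c. f (c i)) {..<s}"
    by (rule P.indep_vars_compose2) auto
  interpret Hf: Hoeffding_ineq ?P "{..<s}" "\<lambda>i c. f (c i)" "\<lambda>_. - B" "\<lambda>_. B"
    "\<Sum>i<s. LINT c|?P. f (c i)"
  proof unfold_locales
    show "AE c in ?P. f (c i) \<in> {- B..B}" if "i \<in> {..<s}" for i
      using that B(1) by (intro AE_I2) (auto simp: space_PiM abs_le_iff dest!: PiE_mem minus_le_iff[THEN iffD1])
  qed (use indep in auto)
  have int: "(LINT c|?P. f (c i)) = (LINT x|D. f x)" if "i < s" for i
    using integral_distr[of "\<lambda>c. c i" ?P D f] that by (simp add: comp)
  \<comment> \<open>Each summand ranges over an interval of length \<open>2 * B\<close>, so the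
    denominator in Hoeffding's exponent is \<open>s\<close> times the square of
    \<open>2 * B\<close>.\<close>
  have "- 2 * (real s * t)\<^sup>2 / (\<Sum>i<s. (B - - B)\<^sup>2) = - (real s * t\<^sup>2 / (2 * B\<^sup>2))"
    using s B(2) by (simp add: field_simps power2_eq_square)
  then show ?thesis
    using Hf.Hoeffding_ineq_le[of "real s * t"] s t B(2) by (simp add: int)
qed

section \<open>Uniform deviation by chaining\<close>

lemma sum_weighted_geometric_le: "(\<Sum>k<n. real (k + 1) / 2 ^ k) \<le> 4"
proof -
  \<comment> \<open>The bound 4 is the limit and does not carry an induction; the exact partial sum
    does.\<close>
  have "(\<Sum>k<n. real (k + 1) / 2 ^ k) = 4 - (2 * real n + 4) / 2 ^ n"
  proof (induction n)
    case (Suc n)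
    have "(2 * real n + 4) / 2 ^ n = (4 * real n + 8) / 2 ^ Suc n"
      and "real (n + 1) / 2 ^ n = (2 * real n + 2) / 2 ^ Suc n"
      by (simp_all add: field_simps)
    with Suc show ?case by (simp add: diff_divide_distrib add_divide_distrib)
  qed simp
  then show ?thesis by simp
qed

text \<open>The union bound runs over the finitely many links of finitely many levels, never over
  \<open>H\<close>, which may be uncountable; one event \<open>E\<close> then serves all
  \<open>h\<close>. Everything is stated for differences with \<open>h0\<close>, because
  \<open>close\<close> bounds these while \<open>F h\<close> alone need not be integrable. Of the
  slack \<open>5 * \<tau>\<close>, the links cost \<open>4 * \<tau>\<close> and cutting the chain at
  a finite level costs \<open>\<tau> / 2\<close> in the mean and \<open>\<tau> / 2\<close> in the
  sample.\<close>

lemma chaining_uniform_deviation: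
  fixes F :: "'h \<Rightarrow> 'a \<Rightarrow> real" and \<pi> :: "nat \<Rightarrow> 'h \<Rightarrow> 'h"
  assumes D: "prob_space D"
    and F: "\<And>h. h \<in> H \<Longrightarrow> F h \<in> borel_measurable D"
    and \<pi>: "\<And>k h. h \<in> H \<Longrightarrow> \<pi> k h \<in> H" and \<pi>0: "\<And>h. h \<in> H \<Longrightarrow> \<pi> 0 h = h0"
    and card: "\<And>k. finite (\<pi> k ` H)" "\<And>k. card (\<pi> k ` H) \<le> 2 ^ ((k + 1) * d)"
    and close: "\<And>k h x. h \<in> H \<Longrightarrow> x \<in> space D \<Longrightarrow> \<bar>F (\<pi> k h) x - F h x\<bar> \<le> R / 2 ^ k"
    and pos: "0 < d" "0 < s" "0 < R" "0 < \<tau>" "0 < \<delta>" "\<delta> < 1"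
    and s: "32 * R\<^sup>2 * (real d + ln (1 / \<delta>)) \<le> real s * \<tau>\<^sup>2"
  shows "\<exists>E\<in>sets (\<Pi>\<^sub>M i\<in>{..<s}. D). 1 - \<delta> \<le> measure (\<Pi>\<^sub>M i\<in>{..<s}. D) E \<and>
           (\<forall>c\<in>E. \<forall>h\<in>H. real s * (LINT x|D. F h x - F h0 x)
                            \<le> (\<Sum>i<s. F h (c i) - F h0 (c i)) + real s * (5 * \<tau>))"
proof -
  interpret D: prob_space D by fact
  interpret P: product_prob_space "\<lambda>_. D" "{..<s}" by unfold_locales
  let ?P = "\<Pi>\<^sub>M i\<in>{..<s}. D"
  \<comment> \<open>Halving with the scale of the nets keeps the Hoeffding exponents from
    degenerating; the factor \<open>k + 1\<close> makes them grow quadratically in \<open>k\<close>,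
    while the logarithm of the number of links grows linearly.\<close>
  define t where "t k = \<tau> * (real (k + 1) / 2 ^ k)" for k
  define J where "J k = (\<lambda>h. (\<pi> (Suc k) h, \<pi> k h)) ` H" for k
  define bad where "bad = (\<lambda>k (a, b). {c \<in> space ?P.
     (\<Sum>i<s. F a (c i) - F b (c i)) \<le> real s * (LINT x|D. F a x - F b x) - real s * t k})"
  \<comment> \<open>At this level the net has scale below \<open>\<tau> / 2\<close>, so the
    remaining step from \<open>\<pi> K h\<close> to \<open>h\<close> needs no probability.\<close>
  obtain K where K: "2 * R / \<tau> < 2 ^ K"
    using real_arch_pow[of 2 "2 * R / \<tau>"] by auto
  define E where "E = space ?P - (\<Union>k<K. \<Union>p\<in>J k. bad k p)"
  have Jsub: "J k \<subseteq> \<pi> (Suc k) ` H \<times> \<pi> k ` H" for k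
    by (auto simp: J_def)
  then have finJ: "finite (J k)" for k
    using card(1) by (meson finite_SigmaI finite_subset)
  have cardJ: "card (J k) \<le> 2 ^ ((2 * k + 3) * d)" for k
  proof -
    have "card (J k) \<le> card (\<pi> (Suc k) ` H \<times> \<pi> k ` H)"
      using Jsub card(1) by (intro card_mono) auto
    also have "\<dots> \<le> 2 ^ ((Suc k + 1) * d) * 2 ^ ((k + 1) * d)"
      unfolding card_cartesian_product by (intro mult_le_mono card(2))
    also have "\<dots> = 2 ^ ((2 * k + 3) * d)"
      by (simp add: power_add[symmetric] algebra_simps)
    finally show ?thesis .
  qed
  \<comment> \<open>The two ends of a link are compared through \<open>h\<close>, at cost
    \<open>R / 2 ^ k + R / 2 ^ Suc k\<close>.\<close>
  have step: "\<bar>F (\<pi> (Suc k) h) x - F (\<pi> k h) x\<bar> \<le> 2 * R / 2 ^ k"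
    if "h \<in> H" "x \<in> space D" for h x k
  proof -
    have "R / 2 ^ Suc k \<le> R / 2 ^ k"
      using pos(3) by (simp add: field_simps)
    then show ?thesis
      using close[OF that, of k] close[OF that, of "Suc k"] by (simp add: abs_le_iff)
  qed
  have meas: "(\<lambda>x. F a x - F b x) \<in> borel_measurable D" if "a \<in> H" "b \<in> H" for a b
    using F that by auto
  have bad_sets: "bad k p \<in> sets ?P" if "p \<in> J k" for k p
  proof -
    from that obtain h where h: "h \<in> H" and p: "p = (\<pi> (Suc k) h, \<pi> k h)"
      by (auto simp: J_def)
    note [measurable] = F[OF \<pi>[OF h]]
    show ?thesis unfolding p bad_def by simp
  qed
  have prob_bad: "measure ?P (bad k p) \<le> exp (- (real s * \<tau>\<^sup>2 * (real (k + 1))\<^sup>2 / (8 * R\<^sup>2)))"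
    if "p \<in> J k" for k p
  proof -
    from that obtain h where h: "h \<in> H" and p: "p = (\<pi> (Suc k) h, \<pi> k h)"
      by (auto simp: J_def)
    have "measure ?P (bad k p) \<le> exp (- (real s * (t k)\<^sup>2 / (2 * (2 * R / 2 ^ k)\<^sup>2)))"
      unfolding p bad_def prod.case
      by (intro prob_sum_PiM_le_Hoeffding D meas \<pi> h step) (use pos in \<open>auto simp: t_def\<close>)
    \<comment> \<open>The powers of 2 in the deviation and in the range of the increment
      cancel.\<close>
    also have "real s * (t k)\<^sup>2 / (2 * (2 * R / 2 ^ k)\<^sup>2) = real s * \<tau>\<^sup>2 * (real (k + 1))\<^sup>2 / (8 * R\<^sup>2)"
      using pos by (simp add: t_def power_mult_distrib power_divide mult_ac)
    finally show ?thesis .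
  qed
  define \<Lambda> where "\<Lambda> = real d + ln (1 / \<delta>)"
  have ln\<delta>: "0 \<le> ln (1 / \<delta>)" using pos by simp
  have level: "measure ?P (\<Union>p\<in>J k. bad k p) \<le> \<delta> / 2 ^ Suc k" for k
  proof -
    have "4 * \<Lambda> * (real (k + 1))\<^sup>2 \<le> real s * \<tau>\<^sup>2 * (real (k + 1))\<^sup>2 / (8 * R\<^sup>2)"
      using mult_right_mono[OF s, of "(real (k + 1))\<^sup>2"] pos by (simp add: \<Lambda>_def field_simps)
    \<comment> \<open>The exponent has to pay for three things: the number of links, a factor
      summable over the levels, and \<open>\<delta>\<close>. Since
      \<open>(2 * k + 3) + (k + 1) \<le> 4 * (k + 1)\<close>, the amount
      \<open>4 * (k + 1) * \<Lambda>\<close> suffices.\<close>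
    moreover have "real ((2 * k + 3) * d) + real (k + 1) + ln (1 / \<delta>) \<le> 4 * \<Lambda> * (real (k + 1))\<^sup>2"
    proof -
      have d1: "1 \<le> real d" using pos by simp
      have "real ((2 * k + 3) * d) + real (k + 1) + ln (1 / \<delta>)
             \<le> real (2 * k + 3) * real d + real (k + 1) * real d + 4 * real (k + 1) * ln (1 / \<delta>)"
      proof -
        have "1 * ln (1 / \<delta>) \<le> 4 * real (k + 1) * ln (1 / \<delta>)"
          by (intro mult_right_mono ln\<delta>) simp
        moreover have "real (k + 1) * 1 \<le> real (k + 1) * real d"
          by (intro mult_left_mono d1) simp
        ultimately show ?thesis
          unfolding of_nat_mult mult_1 mult_1_right by (intro add_mono order_refl)
      qed
      also have "\<dots> \<le> 4 * real (k + 1) * \<Lambda>"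
        by (simp add: \<Lambda>_def algebra_simps)
      also have "\<dots> \<le> 4 * \<Lambda> * (real (k + 1))\<^sup>2"
      proof -
        have "0 \<le> 4 * \<Lambda> * real (k + 1)" using ln\<delta> by (simp add: \<Lambda>_def)
        from mult_left_mono[OF _ this, of 1 "real (k + 1)"] show ?thesis
          by (simp add: power2_eq_square mult_ac)
      qed
      finally show ?thesis .
    qed
    ultimately have "- (real s * \<tau>\<^sup>2 * (real (k + 1))\<^sup>2 / (8 * R\<^sup>2))
        \<le> - real ((2 * k + 3) * d) + - real (Suc k) + ln \<delta>"
      using pos by (simp add: ln_div)
    then have "exp (- (real s * \<tau>\<^sup>2 * (real (k + 1))\<^sup>2 / (8 * R\<^sup>2)))
        \<le> exp (- real ((2 * k + 3) * d) + - real (Suc k) + ln \<delta>)"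
      by (simp only: exp_le_cancel_iff)
    then have e: "exp (- (real s * \<tau>\<^sup>2 * (real (k + 1))\<^sup>2 / (8 * R\<^sup>2)))
        \<le> exp (- real ((2 * k + 3) * d)) * exp (- real (Suc k)) * \<delta>"
      using pos by (simp only: exp_add exp_ln)
    \<comment> \<open>Reading the powers of 2 as powers of e loses only constants and keeps
      \<open>ln 2\<close> out of the estimate.\<close>
    have two: "(2::real) ^ n \<le> exp (real n)" for n
      using power_mono[of 2 "exp 1 :: real" n] exp_ge_add_one_self[of 1]
      by (simp flip: exp_of_nat_mult)
    have "measure ?P (\<Union>p\<in>J k. bad k p) \<le> (\<Sum>p\<in>J k. measure ?P (bad k p))"
      using finJ bad_sets by (intro measure_UNION_le) auto
    also have "\<dots> \<le> real (card (J k)) * exp (- (real s * \<tau>\<^sup>2 * (real (k + 1))\<^sup>2 / (8 * R\<^sup>2)))"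
      by (intro sum_bounded_above prob_bad)
    also have "\<dots> \<le> exp (real ((2 * k + 3) * d)) *
        (exp (- real ((2 * k + 3) * d)) * exp (- real (Suc k)) * \<delta>)"
    proof (intro mult_mono e)
      have "real (card (J k)) \<le> 2 ^ ((2 * k + 3) * d)"
        using cardJ[of k] by (metis numeral_power_le_of_nat_cancel_iff of_nat_le_iff of_nat_numeral of_nat_power)
      also have "\<dots> \<le> exp (real ((2 * k + 3) * d))" by (rule two)
      finally show "real (card (J k)) \<le> exp (real ((2 * k + 3) * d))" .
    qed auto
    also have "\<dots> = \<delta> / exp (real (Suc k))"
      by (simp only: exp_minus) (simp add: field_simps)
    also have "\<dots> \<le> \<delta> / 2 ^ Suc k"
      using pos two[of "Suc k"] by (intro divide_left_mono) auto
    finally show ?thesis .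
  qed
  have Bsets: "(\<Union>p\<in>J k. bad k p) \<in> sets ?P" for k
    using finJ bad_sets by (intro sets.finite_UN) auto
  have "measure ?P (\<Union>k<K. \<Union>p\<in>J k. bad k p) \<le> (\<Sum>k<K. measure ?P (\<Union>p\<in>J k. bad k p))"
    using Bsets by (intro measure_UNION_le) auto
  also have "\<dots> \<le> (\<Sum>k<K. \<delta> / 2 ^ Suc k)"
    by (intro sum_mono level)
  also have "\<dots> = \<delta> * (1 - 1 / 2 ^ K)"
    by (induction K) (auto simp: field_simps)
  also have "\<dots> \<le> \<delta>"
    using pos by (simp add: field_simps)
  finally have "measure ?P (\<Union>k<K. \<Union>p\<in>J k. bad k p) \<le> \<delta>" .
  then have probE: "1 - \<delta> \<le> measure ?P E"
    unfolding E_def using Bsets by (subst P.prob_compl) auto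
  have Esets: "E \<in> sets ?P"
    unfolding E_def using finJ bad_sets by (intro sets.Diff sets.top sets.finite_UN) auto
  have "real s * (LINT x|D. F h x - F h0 x) \<le> (\<Sum>i<s. F h (c i) - F h0 (c i)) + real s * (5 * \<tau>)"
    if c: "c \<in> E" and h: "h \<in> H" for c h
  proof -
    have ci: "c i \<in> space D" if "i < s" for i
      using c that by (auto simp: E_def space_PiM)
    \<comment> \<open>All members of one chain lie within a bounded distance of \<open>h\<close>, so
      their differences are bounded although the functions themselves may not be.\<close>
    have integrable: "integrable D (\<lambda>x. F (\<pi> k h) x - F (\<pi> j h) x)" for k j
    proof (rule D.integrable_const_bound[of _ "R / 2 ^ k + R / 2 ^ j"])
      have "norm (F (\<pi> k h) x - F (\<pi> j h) x) \<le> R / 2 ^ k + R / 2 ^ j" if "x \<in> space D" for x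
        using close[OF h that, of k] close[OF h that, of j] by (simp add: abs_le_iff)
      then show "AE x in D. norm (F (\<pi> k h) x - F (\<pi> j h) x) \<le> R / 2 ^ k + R / 2 ^ j"
        by (intro AE_I2)
    qed (intro meas \<pi> h)
    \<comment> \<open>The increments telescope; outside the bad events the \<open>k\<close>-th one
      contributes at most \<open>real s * t k\<close>.\<close>
    have chain: "real s * (LINT x|D. F (\<pi> n h) x - F (\<pi> 0 h) x)
        \<le> (\<Sum>i<s. F (\<pi> n h) (c i) - F (\<pi> 0 h) (c i)) + real s * (\<Sum>k<n. t k)" if "n \<le> K" for n
      using that
    proof (induction n)
      case (Suc n)
      have "c \<notin> bad n (\<pi> (Suc n) h, \<pi> n h)"
        using c Suc.prems h by (auto simp: E_def J_def)
      then have "real s * (LINT x|D. F (\<pi> (Suc n) h) x - F (\<pi> n h) x)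
          \<le> (\<Sum>i<s. F (\<pi> (Suc n) h) (c i) - F (\<pi> n h) (c i)) + real s * t n"
        using c by (auto simp: bad_def E_def)
      moreover have "(LINT x|D. F (\<pi> (Suc n) h) x - F (\<pi> 0 h) x)
          = (LINT x|D. F (\<pi> (Suc n) h) x - F (\<pi> n h) x) + (LINT x|D. F (\<pi> n h) x - F (\<pi> 0 h) x)"
        using integrable by (subst Bochner_Integration.integral_add[symmetric]) auto
      ultimately show ?case
        using Suc.IH Suc.prems by (simp add: algebra_simps sum_subtractf)
    qed simp
    have RK: "R / 2 ^ K \<le> \<tau> / 2"
      using K pos by (simp add: field_simps)
    \<comment> \<open>This is used twice: under the integral, and at every sample point.\<close>
    have near: "\<bar>F (\<pi> K h) x - F h x\<bar> \<le> \<tau> / 2" if "x \<in> space D" for x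
      using close[OF h that, of K] RK by linarith
    have near': "F h x - F (\<pi> K h) x \<le> \<tau> / 2" "F (\<pi> K h) x - F h x \<le> \<tau> / 2"
      if "x \<in> space D" for x
      using near[OF that] by linarith+
    have int2: "integrable D (\<lambda>x. F h x - F (\<pi> K h) x)"
    proof (rule D.integrable_const_bound[of _ "\<tau> / 2"])
      show "AE x in D. norm (F h x - F (\<pi> K h) x) \<le> \<tau> / 2"
        using near by (intro AE_I2) (simp add: abs_minus_commute)
    qed (intro meas \<pi> h)
    have "(LINT x|D. F h x - F (\<pi> K h) x) \<le> (LINT x|D. \<tau> / 2)"
      by (intro integral_mono int2 near') simp_all
    then have "(LINT x|D. F h x - F (\<pi> K h) x) \<le> \<tau> / 2"
      by (simp add: D.prob_space)
    moreover have "(LINT x|D. F h x - F h0 x)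
        = (LINT x|D. F h x - F (\<pi> K h) x) + (LINT x|D. F (\<pi> K h) x - F (\<pi> 0 h) x)"
      using integrable[of K 0] int2 by (subst Bochner_Integration.integral_add[symmetric]) (auto simp: \<pi>0[OF h])
    ultimately have "real s * (LINT x|D. F h x - F h0 x)
        \<le> real s * (\<tau> / 2) + real s * (LINT x|D. F (\<pi> K h) x - F (\<pi> 0 h) x)"
      unfolding distrib_left[symmetric] by (intro mult_left_mono) auto
    also have "\<dots> \<le> real s * (\<tau> / 2) + ((\<Sum>i<s. F (\<pi> K h) (c i) - F (\<pi> 0 h) (c i)) + real s * (4 * \<tau>))"
    proof -
      have "(\<Sum>k<K. t k) \<le> 4 * \<tau>"
        using sum_weighted_geometric_le[of K] pos unfolding t_def sum_distrib_left[symmetric]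
        by simp
      then show ?thesis
        using chain[of K] mult_left_mono[of "\<Sum>k<K. t k" "4 * \<tau>" "real s"]
        unfolding add_le_cancel_left by linarith
    qed
    also have "(\<Sum>i<s. F (\<pi> K h) (c i) - F (\<pi> 0 h) (c i)) \<le> (\<Sum>i<s. (F h (c i) - F h0 (c i)) + \<tau> / 2)"
    proof (intro sum_mono)
      fix i assume "i \<in> {..<s}"
      then show "F (\<pi> K h) (c i) - F (\<pi> 0 h) (c i) \<le> (F h (c i) - F h0 (c i)) + \<tau> / 2"
        using near'(2)[OF ci[of i]] by (simp add: \<pi>0[OF h])
    qed
    also have "\<dots> = (\<Sum>i<s. F h (c i) - F h0 (c i)) + real s * (\<tau> / 2)"
      by (simp add: sum.distrib)
    finally show ?thesis
      by (simp add: algebra_simps)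
  qed
  with probE Esets show ?thesis by blast
qed

section \<open>The sup norm and the Lipschitz property of the loss\<close>

lemma linf_norm_nonneg: "0 \<le> linf_norm n x"
  by (simp add: linf_norm_def)

lemma linf_norm_le_iff: "linf_norm n x \<le> B \<longleftrightarrow> 0 \<le> B \<and> (\<forall>i<n. \<bar>x i\<bar> \<le> B)"
  by (auto simp: linf_norm_def)

lemma abs_le_linf_norm: "i < n \<Longrightarrow> \<bar>x i\<bar> \<le> linf_norm n x"
  using linf_norm_le_iff[of n x "linf_norm n x"] by simp

lemma linf_loss_le:
  "linf_loss d hstar h c \<le> linf_loss d hstar h' c + linf_norm d (\<lambda>i. h' i - h i)"
proof -
  have "\<bar>hstar c i - h i\<bar> \<le> linf_loss d hstar h' c + linf_norm d (\<lambda>i. h' i - h i)" if "i < d" for i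
  proof -
    have "\<bar>hstar c i - h' i\<bar> \<le> linf_loss d hstar h' c" "\<bar>h' i - h i\<bar> \<le> linf_norm d (\<lambda>i. h' i - h i)"
      using that abs_le_linf_norm[of i d "\<lambda>i. hstar c i - h' i"] abs_le_linf_norm[of i d "\<lambda>i. h' i - h i"]
      by (simp_all add: linf_loss_def)
    then show ?thesis by linarith
  qed
  then show ?thesis
    by (subst (1) linf_loss_def) (simp add: linf_norm_le_iff linf_norm_nonneg linf_loss_def)
qed

lemma linf_norm_diff_commute: "linf_norm d (\<lambda>i. x i - y i) = linf_norm d (\<lambda>i. y i - x i)"
  by (simp add: linf_norm_def abs_minus_commute)

text \<open>The triangle inequality in both directions. The bound is free of \<open>c\<close> and
  \<open>hstar\<close>, so a net of \<open>H\<close> is at once a net of the losses, uniformly over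
  the instances.\<close>

lemma abs_linf_loss_diff_le:
  "\<bar>linf_loss d hstar h c - linf_loss d hstar h' c\<bar> \<le> linf_norm d (\<lambda>i. h i - h' i)"
  using linf_loss_le[of d hstar h c h'] linf_loss_le[of d hstar h' c h]
    linf_norm_diff_commute[of d h h'] by linarith

section \<open>Nets of a subset of a box\<close>

text \<open>The box is cut into cells of side \<open>2 * M / 2 ^ k\<close>, and each cell that meets
  \<open>H\<close> is represented by a point of \<open>H\<close>. Centres of cells would not do:
  \<open>H\<close> is arbitrary, and the losses are known to be measurable only for hints in
  \<open>H\<close>. At level 0 the single point \<open>h0\<close> suffices, as the box has diameter
  \<open>2 * M\<close>.\<close>

lemma linf_box_nets:
  assumes box: "\<forall>h\<in>H. \<forall>i<d. h i \<in> {-M..M}" and M: "0 < M" and h0: "h0 \<in> H"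
  shows "\<exists>\<pi> :: nat \<Rightarrow> (nat \<Rightarrow> real) \<Rightarrow> nat \<Rightarrow> real.
    \<forall>k. finite (\<pi> k ` H) \<and> card (\<pi> k ` H) \<le> 2 ^ ((k + 1) * d) \<and>
        (\<forall>h\<in>H. \<pi> k h \<in> H \<and> \<pi> 0 h = h0 \<and> linf_norm d (\<lambda>i. \<pi> k h i - h i) \<le> 2 * M / 2 ^ k)"
proof -
  define cell where "cell k h = (\<lambda>i\<in>{..<d}. nat \<lfloor>(h i + M) * 2 ^ k / (2 * M)\<rfloor>)" for k and h :: "nat \<Rightarrow> real"
  \<comment> \<open>The choice depends on \<open>h\<close> only through its cell, so there are at
    most as many representatives as cells.\<close>
  define \<pi> where "\<pi> k h = (if k = 0 then h0 else SOME g. g \<in> H \<and> cell k g = cell k h)" for k h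
  have \<pi>: "\<pi> k h \<in> H" "k \<noteq> 0 \<Longrightarrow> cell k (\<pi> k h) = cell k h" if "h \<in> H" for k h
  proof -
    have "\<exists>g. g \<in> H \<and> cell k g = cell k h" using that by blast
    from someI_ex[OF this] show "\<pi> k h \<in> H" "k \<noteq> 0 \<Longrightarrow> cell k (\<pi> k h) = cell k h"
      using h0 by (auto simp: \<pi>_def)
  qed
  have cells: "cell k ` H \<subseteq> {..<d} \<rightarrow>\<^sub>E {..2 ^ k}" for k
  proof -
    have "nat \<lfloor>(h i + M) * 2 ^ k / (2 * M)\<rfloor> \<le> 2 ^ k" if "h \<in> H" "i < d" for h i
    proof -
      have "(h i + M) * 2 ^ k / (2 * M) \<le> 2 ^ k"
        using box[rule_format, OF that] M by (simp add: field_simps)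
      then have "\<lfloor>(h i + M) * 2 ^ k / (2 * M)\<rfloor> \<le> 2 ^ k"
        by (simp add: floor_le_iff)
      then show ?thesis by (simp add: nat_le_iff)
    qed
    then show ?thesis
      unfolding cell_def by (intro image_subsetI) (simp add: PiE_iff)
  qed
  have fin_cells: "finite (cell k ` H)" and card_cells: "card (cell k ` H) \<le> 2 ^ ((k + 1) * d)" for k
  proof -
    show "finite (cell k ` H)"
      using cells by (rule finite_subset) (auto intro: finite_PiE)
    have "card (cell k ` H) \<le> card ({..<d} \<rightarrow>\<^sub>E {..(2::nat) ^ k})"
      using cells by (intro card_mono) (auto intro: finite_PiE)
    also have "\<dots> = (2 ^ k + 1) ^ d"
      by (simp add: card_PiE)
    \<comment> \<open>A coordinate equal to \<open>M\<close> falls into an extra cell with index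
      \<open>2 ^ k\<close>; hence \<open>2 ^ k + 1\<close> cells per coordinate, absorbed by one
      more doubling.\<close>
    also have "\<dots> \<le> (2 ^ (k + 1)) ^ d"
      by (intro power_mono) auto
    finally show "card (cell k ` H) \<le> 2 ^ ((k + 1) * d)"
      by (simp only: power_mult)
  qed
  have sub: "\<pi> k ` H \<subseteq> (\<lambda>v. if k = 0 then h0 else SOME g. g \<in> H \<and> cell k g = v) ` (cell k ` H)" for k
    by (auto simp: \<pi>_def)
  have fin: "finite (\<pi> k ` H)" for k
    using sub fin_cells by (meson finite_imageI finite_subset)
  have card: "card (\<pi> k ` H) \<le> 2 ^ ((k + 1) * d)" for k
    using surj_card_le[OF fin_cells sub] card_cells[of k] by (meson le_trans)
  have "\<bar>\<pi> k h i - h i\<bar> \<le> 2 * M / 2 ^ k" if h: "h \<in> H" and i: "i < d" for k h i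
  proof (cases "k = 0")
    case True
    then show ?thesis using box[rule_format, OF h i] box[rule_format, OF h0 i] by (auto simp: \<pi>_def abs_le_iff)
  next
    case False
    let ?u = "\<lambda>g. (g i + M) * 2 ^ k / (2 * M)"
    \<comment> \<open>\<open>nat\<close> would identify all negative floors; nonnegativity allows
      removing it, and equal floors then put the scaled coordinates within 1 of each other.\<close>
    have nonneg: "0 \<le> ?u g" if "g \<in> H" for g
      using box[rule_format, OF that i] M by simp
    have "nat \<lfloor>?u (\<pi> k h)\<rfloor> = nat \<lfloor>?u h\<rfloor>"
      using fun_cong[OF \<pi>(2)[OF h False], of i] i by (simp add: cell_def)
    then have "\<lfloor>?u (\<pi> k h)\<rfloor> = \<lfloor>?u h\<rfloor>"
      using nonneg[OF h] nonneg[OF \<pi>(1)[OF h]] by (simp add: eq_nat_nat_iff)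
    then have "\<bar>?u (\<pi> k h) - ?u h\<bar> \<le> 1"
      by linarith
    moreover have "?u (\<pi> k h) - ?u h = (\<pi> k h i - h i) * (2 ^ k / (2 * M))"
      using M by (simp add: field_simps)
    ultimately have "\<bar>\<pi> k h i - h i\<bar> * (2 ^ k / (2 * M)) \<le> 1"
      using M by (simp only: abs_mult) simp
    then show ?thesis
      using M by (simp add: field_simps)
  qed
  then have "\<forall>k. finite (\<pi> k ` H) \<and> card (\<pi> k ` H) \<le> 2 ^ ((k + 1) * d) \<and>
        (\<forall>h\<in>H. \<pi> k h \<in> H \<and> \<pi> 0 h = h0 \<and> linf_norm d (\<lambda>i. \<pi> k h i - h i) \<le> 2 * M / 2 ^ k)"
    using fin card \<pi>(1) M by (auto simp: linf_norm_le_iff \<pi>_def[of 0])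
  then show ?thesis by blast
qed

section \<open>Empirical risk minimization with enough samples\<close>

lemma linf_loss_le_diameter:
  assumes "\<forall>h\<in>H. \<forall>i<d. h i \<in> {-M..M}" "0 \<le> M" "h \<in> H" "hstar c \<in> H"
  shows "linf_loss d hstar h c \<le> 2 * M"
  unfolding linf_loss_def linf_norm_le_iff
proof (intro conjI allI impI)
  fix i assume "i < d"
  with assms(1)[rule_format, OF assms(3) this] assms(1)[rule_format, OF assms(4) this] show "\<bar>hstar c i - h i\<bar> \<le> 2 * M"
    by (auto simp: abs_le_iff)
qed (use assms in auto)

text \<open>Chaining is used with \<open>R = 2 * M\<close> and
  \<open>\<tau> = \<epsilon> / 10\<close>, so \<open>5 * \<tau> = \<epsilon> / 2\<close> and 12800
  is 32 times the squares of 2 and 10. The good event comes from chaining alone and covers every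
  hint in \<open>H\<close>, so \<open>A\<close> may depend on the samples in a nonmeasurable
  way.\<close>

lemma erm_linf_loss:
  assumes D: "weight_distribution m d H hstar D" and hstar: "\<And>c. c \<in> rvec m \<Longrightarrow> hstar c \<in> H"
    and box: "\<forall>h\<in>H. \<forall>i<d. h i \<in> {-M..M}"
    and pos: "0 < \<epsilon>" "0 < \<delta>" "\<delta> < 1" "0 < d" "0 < M" "0 < s"
    and s: "12800 * (M / \<epsilon>)\<^sup>2 * (real d + ln (1 / \<delta>)) \<le> real s"
    and erm: "\<And>c. c \<in> {..<s} \<rightarrow>\<^sub>E rvec m \<Longrightarrow>
      is_arg_min (\<lambda>h. \<Sum>i<s. linf_loss d hstar h (c i)) (\<lambda>h. h \<in> H) (A c)"
  shows "with_prob_at_least (\<Pi>\<^sub>M i\<in>{..<s}. D) (1 - \<delta>)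
           (\<lambda>c. (LINT x|D. linf_loss d hstar (A c) x) \<le> (INF h'\<in>H. LINT x|D. linf_loss d hstar h' x) + \<epsilon>)"
proof -
  let ?L = "\<lambda>h. LINT x|D. linf_loss d hstar h x"
  have space: "space D = rvec m" and meas: "\<And>h. h \<in> H \<Longrightarrow> linf_loss d hstar h \<in> borel_measurable D"
    and prob: "prob_space D"
    using D by (auto simp: weight_distribution_def)
  interpret D: prob_space D by fact
  have "H \<noteq> {}"
    using hstar[of "\<lambda>i\<in>{..<m}. 0"] by auto
  have int: "integrable D (linf_loss d hstar h)" if "h \<in> H" for h
  proof (rule D.integrable_const_bound[of _ "2 * M"])
    show "AE x in D. norm (linf_loss d hstar h x) \<le> 2 * M"
      using linf_loss_le_diameter[where hstar = hstar, OF box _ that hstar] pos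
      by (intro AE_I2) (auto simp: space linf_loss_def linf_norm_nonneg)
  qed (rule meas[OF that])
  have "bdd_below (?L ` H)"
    by (intro bdd_belowI2[where m = 0] integral_nonneg_AE AE_I2) (auto simp: linf_loss_def linf_norm_nonneg)
  \<comment> \<open>The infimum need not be attained; half of \<open>\<epsilon>\<close> pays for
    near optimality of \<open>h0\<close>, the other half for the deviation.\<close>
  then obtain h0 where h0: "h0 \<in> H" "?L h0 < (INF h'\<in>H. ?L h') + \<epsilon> / 2"
    using cINF_less_iff[OF \<open>H \<noteq> {}\<close>, of ?L "(INF h'\<in>H. ?L h') + \<epsilon> / 2"] pos by auto
  obtain \<pi> where net: "\<forall>k. finite (\<pi> k ` H) \<and> card (\<pi> k ` H) \<le> 2 ^ ((k + 1) * d) \<and>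
      (\<forall>h\<in>H. \<pi> k h \<in> H \<and> \<pi> 0 h = h0 \<and> linf_norm d (\<lambda>i. \<pi> k h i - h i) \<le> 2 * M / 2 ^ k)"
    using linf_box_nets[OF box pos(5) h0(1)] by (elim exE) auto
  have \<pi>: "\<And>k. finite (\<pi> k ` H)" "\<And>k. card (\<pi> k ` H) \<le> 2 ^ ((k + 1) * d)"
    "\<And>k h. h \<in> H \<Longrightarrow> \<pi> k h \<in> H" "\<And>h. h \<in> H \<Longrightarrow> \<pi> 0 h = h0"
    "\<And>k h. h \<in> H \<Longrightarrow> linf_norm d (\<lambda>i. \<pi> k h i - h i) \<le> 2 * M / 2 ^ k"
    using net by blast+
  have "\<exists>E\<in>sets (\<Pi>\<^sub>M i\<in>{..<s}. D). 1 - \<delta> \<le> measure (\<Pi>\<^sub>M i\<in>{..<s}. D) E \<and>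
      (\<forall>c\<in>E. \<forall>h\<in>H. real s * (LINT x|D. linf_loss d hstar h x - linf_loss d hstar h0 x)
         \<le> (\<Sum>i<s. linf_loss d hstar h (c i) - linf_loss d hstar h0 (c i)) + real s * (5 * (\<epsilon> / 10)))"
  proof (rule chaining_uniform_deviation[where \<pi> = \<pi> and R = "2 * M" and d = d])
    show "\<bar>linf_loss d hstar (\<pi> k h) x - linf_loss d hstar h x\<bar> \<le> 2 * M / 2 ^ k" if "h \<in> H" for k h x
      using abs_linf_loss_diff_le \<pi>(5)[OF that] by (rule order_trans)
    show "32 * (2 * M)\<^sup>2 * (real d + ln (1 / \<delta>)) \<le> real s * (\<epsilon> / 10)\<^sup>2"
      using s pos by (simp add: field_simps power2_eq_square)
  qed (use \<pi> pos prob meas in auto)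
  then obtain E where E: "E \<in> sets (\<Pi>\<^sub>M i\<in>{..<s}. D)" "1 - \<delta> \<le> measure (\<Pi>\<^sub>M i\<in>{..<s}. D) E"
    and dev: "\<And>c h. c \<in> E \<Longrightarrow> h \<in> H \<Longrightarrow>
      real s * (LINT x|D. linf_loss d hstar h x - linf_loss d hstar h0 x)
         \<le> (\<Sum>i<s. linf_loss d hstar h (c i) - linf_loss d hstar h0 (c i)) + real s * (5 * (\<epsilon> / 10))"
    by blast
  have "?L (A c) \<le> (INF h'\<in>H. ?L h') + \<epsilon>" if c: "c \<in> E" for c
  proof -
    have "c \<in> space (\<Pi>\<^sub>M i\<in>{..<s}. D)"
      using E(1) c sets.sets_into_space by blast
    then have "is_arg_min (\<lambda>h. \<Sum>i<s. linf_loss d hstar h (c i)) (\<lambda>h. h \<in> H) (A c)"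
      by (intro erm) (simp add: space_PiM space)
    then have A: "A c \<in> H" and le: "(\<Sum>i<s. linf_loss d hstar (A c) (c i)) \<le> (\<Sum>i<s. linf_loss d hstar h0 (c i))"
      using h0(1) by (auto simp: is_arg_min_linorder)
    \<comment> \<open>By minimality the empirical difference with \<open>h0\<close> is at most 0,
      which leaves only the slack.\<close>
    have "real s * (?L (A c) - ?L h0) \<le> real s * (\<epsilon> / 2)"
      using dev[OF c A] le int[OF A] int[OF h0(1)] by (simp add: sum_subtractf)
    then have "?L (A c) - ?L h0 \<le> \<epsilon> / 2"
      using pos by simp
    then show ?thesis using h0(2) by linarith
  qed
  with E show ?thesis
    unfolding with_prob_at_least_def by blast
qed

section \<open>The sample size, including degenerate parameters\<close>

text \<open>Losses are nonnegative, so the infimum is too, and a hint with expected loss at most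
  \<open>\<epsilon>\<close> competes with it.\<close>

lemma loss_le_accuracy_imp_excess_le:
  assumes D: "weight_distribution m d H hstar D" and h: "h \<in> H" and "0 < \<epsilon>"
    and small: "\<And>h c. h \<in> H \<Longrightarrow> c \<in> rvec m \<Longrightarrow> linf_loss d hstar h c \<le> \<epsilon>"
  shows "(LINT x|D. linf_loss d hstar h x) \<le> (INF h'\<in>H. LINT x|D. linf_loss d hstar h' x) + \<epsilon>"
proof -
  interpret D: prob_space D using D by (simp add: weight_distribution_def)
  have space: "space D = rvec m" using D by (simp add: weight_distribution_def)
  have "(LINT x|D. linf_loss d hstar h x) \<le> \<epsilon>"
  proof (rule D.integral_le_const)
    show "integrable D (linf_loss d hstar h)"
      using D h small[OF h] by (intro D.integrable_const_bound[of _ \<epsilon>] AE_I2)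
        (auto simp: weight_distribution_def linf_loss_def linf_norm_nonneg)
  qed (use small[OF h] space in auto)
  moreover have "0 \<le> (INF h'\<in>H. LINT x|D. linf_loss d hstar h' x)"
    using h by (intro cINF_greatest integral_nonneg_AE AE_I2) (auto simp: linf_loss_def linf_norm_nonneg)
  ultimately show ?thesis by linarith
qed

text \<open>
  Rounding down may give \<open>0\<close> samples, but only if \<open>d = 0\<close> or \<open>2 M \<le> \<epsilon>\<close>, where every hint is good enough.
\<close>

definition sample_size :: "nat \<Rightarrow> real \<Rightarrow> real \<Rightarrow> real \<Rightarrow> nat" where
  "sample_size d M \<epsilon> \<delta> = nat \<lfloor>25600 * ((real d * M / \<epsilon>)\<^sup>2 * (real d + ln (1 / \<delta>)))\<rfloor>"

lemma sample_size_le: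
  assumes "0 < \<delta>" "\<delta> < 1"
  shows "real (sample_size d M \<epsilon> \<delta>) \<le> 25600 * ((real d * M / \<epsilon>)\<^sup>2 * (real d + ln (1 / \<delta>)))"
proof -
  have "0 \<le> ln (1 / \<delta>)" using assms by simp
  then show ?thesis unfolding sample_size_def by (intro of_nat_floor) simp
qed

text \<open>The constant 25600 is twice 12800: rounding down loses at most 1, hence at most half of
  a number that is at least 2. That it is at least 2 follows from
  \<open>M / \<epsilon> > 1 / 2\<close> and \<open>\<Lambda> \<ge> 1\<close>.\<close>

lemma sample_size_ge:
  assumes "0 < \<epsilon>" "0 < \<delta>" "\<delta> < 1" "0 < d" "\<epsilon> < 2 * M"
  shows "12800 * (M / \<epsilon>)\<^sup>2 * (real d + ln (1 / \<delta>)) \<le> real (sample_size d M \<epsilon> \<delta>)"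
    and "0 < sample_size d M \<epsilon> \<delta>"
proof -
  define \<Lambda> where "\<Lambda> = real d + ln (1 / \<delta>)"
  let ?x = "25600 * ((real d * M / \<epsilon>)\<^sup>2 * \<Lambda>)"
  have "0 \<le> ln (1 / \<delta>)" using assms by simp
  moreover have "1 \<le> real d" using assms by simp
  ultimately have \<Lambda>: "1 \<le> \<Lambda>" unfolding \<Lambda>_def by linarith
  have "1 / 2 \<le> M / \<epsilon>" using assms by (simp add: field_simps)
  from power_mono[OF this, of 2] have Me: "1 / 4 \<le> (M / \<epsilon>)\<^sup>2" by (simp add: power2_eq_square)
  have "1 * (M / \<epsilon>)\<^sup>2 \<le> (real d)\<^sup>2 * (M / \<epsilon>)\<^sup>2"
    using assms by (intro mult_right_mono) auto
  then have ge: "(M / \<epsilon>)\<^sup>2 \<le> (real d * M / \<epsilon>)\<^sup>2" by (simp add: power_mult_distrib power_divide)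
  from mult_right_mono[OF ge, of \<Lambda>] \<Lambda> have ge': "(M / \<epsilon>)\<^sup>2 * \<Lambda> \<le> (real d * M / \<epsilon>)\<^sup>2 * \<Lambda>" by simp
  have "1 / 4 * 1 \<le> (M / \<epsilon>)\<^sup>2 * \<Lambda>" using Me \<Lambda> by (intro mult_mono) auto
  then have x: "2 \<le> ?x" using ge' by linarith
  have "?x - 1 \<le> real (sample_size d M \<epsilon> \<delta>)"
    unfolding sample_size_def \<Lambda>_def[symmetric] by linarith
  then have "?x / 2 \<le> real (sample_size d M \<epsilon> \<delta>)" using x by linarith
  moreover have "12800 * ((M / \<epsilon>)\<^sup>2 * \<Lambda>) \<le> ?x / 2" using ge' by linarith
  ultimately show "12800 * (M / \<epsilon>)\<^sup>2 * (real d + ln (1 / \<delta>)) \<le> real (sample_size d M \<epsilon> \<delta>)"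
    and "0 < sample_size d M \<epsilon> \<delta>"
    using x by (auto simp: \<Lambda>_def[symmetric] mult.assoc intro: gr0I)
qed

lemma erm_sample_size:
  assumes D: "weight_distribution m d H hstar D" and hstar: "\<And>c. c \<in> rvec m \<Longrightarrow> hstar c \<in> H"
    and box: "\<forall>h\<in>H. \<forall>i<d. h i \<in> {-M..M}"
    and pos: "0 < \<epsilon>" "0 < \<delta>" "\<delta> < 1"
    and s: "s = sample_size d M \<epsilon> \<delta>"
    and erm: "\<And>c. c \<in> {..<s} \<rightarrow>\<^sub>E rvec m \<Longrightarrow>
      is_arg_min (\<lambda>h. \<Sum>i<s. linf_loss d hstar h (c i)) (\<lambda>h. h \<in> H) (A c)"
  shows "with_prob_at_least (\<Pi>\<^sub>M i\<in>{..<s}. D) (1 - \<delta>)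
           (\<lambda>c. (LINT x|D. linf_loss d hstar (A c) x) \<le> (INF h'\<in>H. LINT x|D. linf_loss d hstar h' x) + \<epsilon>)"
proof (cases "0 < d \<and> \<epsilon> < 2 * M")
  case True
  then show ?thesis
    using assms sample_size_ge[OF pos, of d M] by (intro erm_linf_loss[OF D hstar box pos]) auto
next
  case False
  have small: "linf_loss d hstar h c \<le> \<epsilon>" if "h \<in> H" "c \<in> rvec m" for h c
  proof (cases "d = 0")
    case True
    then show ?thesis using pos by (simp add: linf_loss_def linf_norm_def)
  next
    case d: False
    \<comment> \<open>Coordinate 0 of a hint lies in \<open>{-M..M}\<close>, so this interval is not
      empty.\<close>
    then have "0 \<le> M" using box[rule_format, OF that(1), of 0] by auto
    then have "linf_loss d hstar h c \<le> 2 * M"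
      using box that(1) hstar[OF that(2)] by (intro linf_loss_le_diameter[where H = H]) auto
    then show ?thesis using False d by simp
  qed
  interpret D: prob_space D using D by (simp add: weight_distribution_def)
  \<comment> \<open>When every hint is good enough, the whole space serves as the event.\<close>
  have "measure (\<Pi>\<^sub>M i\<in>{..<s}. D) (space (\<Pi>\<^sub>M i\<in>{..<s}. D)) = 1"
    by (intro prob_space.prob_space prob_space_PiM D.prob_space_axioms)
  moreover have "A c \<in> H" if "c \<in> space (\<Pi>\<^sub>M i\<in>{..<s}. D)" for c
    using erm[of c] that D by (auto simp: is_arg_min_def space_PiM weight_distribution_def)
  ultimately show ?thesis
    unfolding with_prob_at_least_def using pos
    by (intro bexI[of _ "space (\<Pi>\<^sub>M i\<in>{..<s}. D)"] conjI ballI loss_le_accuracy_imp_excess_le[OF D _ pos(1) small]) auto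
qed

section \<open>Polynomial-time learning of hints\<close>

text \<open>\<open>C\<close> and \<open>S\<close> are chosen before all problem data, so the
  constant is absolute and the sample size depends only on \<open>d\<close>, \<open>M\<close>,
  \<open>\<epsilon>\<close> and \<open>\<delta>\<close>; \<open>q'\<close> depends only on
  \<open>q\<close>. One algorithm serves every accuracy, confidence and distribution. The infimum
  equals the minimum whenever the latter exists.\<close>

theorem theorem6p2:
  "\<exists>(C :: real) > 0. \<exists>S :: nat \<Rightarrow> real \<Rightarrow> real \<Rightarrow> real \<Rightarrow> nat.
     (\<forall>d M \<epsilon> \<delta>. 0 < \<epsilon> \<and> 0 < \<delta> \<and> \<delta> < 1 \<longrightarrow>
        real (S d M \<epsilon> \<delta>) \<le> C * ((real d * M / \<epsilon>)\<^sup>2 * (real d + ln (1 / \<delta>)))) \<and>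
     (\<forall>q :: nat poly. \<exists>q' :: nat poly.
        \<forall>(G :: graph) (d :: nat) (H :: (nat \<Rightarrow> real) set)
         (hstar :: (nat \<Rightarrow> real) \<Rightarrow> nat \<Rightarrow> real) (M :: real).
          finite_graph G \<and> H \<subseteq> rvec d \<and> (\<forall>c\<in>rvec (num_edges G). hstar c \<in> H) \<and>
          (\<forall>h\<in>H. \<forall>i<d. h i \<in> {-M..M}) \<and>
          (\<exists>A. computable_in_time q (num_edges G) d A \<and>
             (\<forall>s. \<forall>c \<in> {..<s} \<rightarrow>\<^sub>E rvec (num_edges G).
                is_arg_min (\<lambda>h. \<Sum>i<s. linf_loss d hstar h (c i)) (\<lambda>h. h \<in> H) (A s c)))
          \<longrightarrow>
          (\<exists>A. computable_in_time q' (num_edges G) d A \<and>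
             (\<forall>s. \<forall>c \<in> {..<s} \<rightarrow>\<^sub>E rvec (num_edges G). A s c \<in> H) \<and>
             (\<forall>\<epsilon> \<delta> D. 0 < \<epsilon> \<and> 0 < \<delta> \<and> \<delta> < 1 \<and>
                weight_distribution (num_edges G) d H hstar D \<longrightarrow>
                with_prob_at_least (\<Pi>\<^sub>M i\<in>{..<S d M \<epsilon> \<delta>}. D) (1 - \<delta>)
                  (\<lambda>c. (LINT x|D. linf_loss d hstar (A (S d M \<epsilon> \<delta>) c) x)
                         \<le> (INF h'\<in>H. LINT x|D. linf_loss d hstar h' x) + \<epsilon>))))"
proof (intro exI[of _ "25600 :: real"] exI[of _ sample_size] conjI allI impI)
  show "(0 :: real) < 25600" by simp
  show "real (sample_size d M \<epsilon> \<delta>) \<le> 25600 * ((real d * M / \<epsilon>)\<^sup>2 * (real d + ln (1 / \<delta>)))"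
    if "0 < \<epsilon> \<and> 0 < \<delta> \<and> \<delta> < 1" for d M \<epsilon> \<delta>
    using that by (intro sample_size_le) auto
next
  fix q :: "nat poly"
  show "\<exists>q' :: nat poly.
        \<forall>(G :: graph) (d :: nat) (H :: (nat \<Rightarrow> real) set)
         (hstar :: (nat \<Rightarrow> real) \<Rightarrow> nat \<Rightarrow> real) (M :: real).
          finite_graph G \<and> H \<subseteq> rvec d \<and> (\<forall>c\<in>rvec (num_edges G). hstar c \<in> H) \<and>
          (\<forall>h\<in>H. \<forall>i<d. h i \<in> {-M..M}) \<and>
          (\<exists>A. computable_in_time q (num_edges G) d A \<and>
             (\<forall>s. \<forall>c \<in> {..<s} \<rightarrow>\<^sub>E rvec (num_edges G).
                is_arg_min (\<lambda>h. \<Sum>i<s. linf_loss d hstar h (c i)) (\<lambda>h. h \<in> H) (A s c)))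
          \<longrightarrow>
          (\<exists>A. computable_in_time q' (num_edges G) d A \<and>
             (\<forall>s. \<forall>c \<in> {..<s} \<rightarrow>\<^sub>E rvec (num_edges G). A s c \<in> H) \<and>
             (\<forall>\<epsilon> \<delta> D. 0 < \<epsilon> \<and> 0 < \<delta> \<and> \<delta> < 1 \<and>
                weight_distribution (num_edges G) d H hstar D \<longrightarrow>
                with_prob_at_least (\<Pi>\<^sub>M i\<in>{..<sample_size d M \<epsilon> \<delta>}. D) (1 - \<delta>)
                  (\<lambda>c. (LINT x|D. linf_loss d hstar (A (sample_size d M \<epsilon> \<delta>) c) x)
                         \<le> (INF h'\<in>H. LINT x|D. linf_loss d hstar h' x) + \<epsilon>)))"
  \<comment> \<open>The learner is the given empirical minimizer itself, so its time bound carries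
    over with \<open>q' = q\<close>.\<close>
  proof (intro exI[of _ q] allI impI, elim conjE exE)
    fix G :: graph and d :: nat and H :: "(nat \<Rightarrow> real) set"
      and hstar :: "(nat \<Rightarrow> real) \<Rightarrow> nat \<Rightarrow> real" and M :: real and A
    assume hstar: "\<forall>c\<in>rvec (num_edges G). hstar c \<in> H" and box: "\<forall>h\<in>H. \<forall>i<d. h i \<in> {-M..M}"
      and time: "computable_in_time q (num_edges G) d A"
      and erm: "\<forall>s. \<forall>c \<in> {..<s} \<rightarrow>\<^sub>E rvec (num_edges G).
                is_arg_min (\<lambda>h. \<Sum>i<s. linf_loss d hstar h (c i)) (\<lambda>h. h \<in> H) (A s c)"
    have "A s c \<in> H" if "c \<in> {..<s} \<rightarrow>\<^sub>E rvec (num_edges G)" for s c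
      using erm that by (auto simp: is_arg_min_def)
    moreover have "with_prob_at_least (\<Pi>\<^sub>M i\<in>{..<sample_size d M \<epsilon> \<delta>}. D) (1 - \<delta>)
                  (\<lambda>c. (LINT x|D. linf_loss d hstar (A (sample_size d M \<epsilon> \<delta>) c) x)
                         \<le> (INF h'\<in>H. LINT x|D. linf_loss d hstar h' x) + \<epsilon>)"
      if "0 < \<epsilon> \<and> 0 < \<delta> \<and> \<delta> < 1 \<and> weight_distribution (num_edges G) d H hstar D" for \<epsilon> \<delta> D
      using that hstar box erm by (intro erm_sample_size[where m = "num_edges G" and M = M]) auto
    ultimately show "\<exists>A. computable_in_time q (num_edges G) d A \<and>
             (\<forall>s. \<forall>c \<in> {..<s} \<rightarrow>\<^sub>E rvec (num_edges G). A s c \<in> H) \<and>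
             (\<forall>\<epsilon> \<delta> D. 0 < \<epsilon> \<and> 0 < \<delta> \<and> \<delta> < 1 \<and>
                weight_distribution (num_edges G) d H hstar D \<longrightarrow>
                with_prob_at_least (\<Pi>\<^sub>M i\<in>{..<sample_size d M \<epsilon> \<delta>}. D) (1 - \<delta>)
                  (\<lambda>c. (LINT x|D. linf_loss d hstar (A (sample_size d M \<epsilon> \<delta>) c) x)
                         \<le> (INF h'\<in>H. LINT x|D. linf_loss d hstar h' x) + \<epsilon>))"
      using time by blast
  qed
qed

end
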